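(* Let $(G,\lambda)$ be an edge-labeled finite simple graph. Then $\lambda$ is an MAT-labeling of $G$ if and only if there exists an MAT-perfect elimination ordering of $(G,\lambda)$.
   Context: An edge-labeled graph is a simple graph $G$ with a map $\lambda:E_G\to\mathbb{Z}_{>0}$. MAT-labeling: put $\pi_k=\lambda^{-1}(k)$, $E_k=\pi_1\sqcup\dots\sqcup\pi_k$, $E_0=\varnothing$; $\operatorname{cl}(F)$ is the set of edges whose endvertices are joined by a path of edges in $F$; $\lambda$ is an MAT-labeling if for all $k\ge1$: (ML1) $\pi_k$ is a forest; (ML2) $\operatorname{cl}(\pi_k)\cap E_{k-1}=\varnothing$; (ML3) each $\{u,u'\}\in\pi_k$ has exactly $k-1$ vertices $w$ with $\{u,w\},\{u',w\}\in E_{k-1}$. A vertex $v$ is MAT-simplicial in $(G,\lambda)$ if: (MS1) $N_G(v)$ is a clique; (MS2) $\{\lambda(\{u,v\})\mid u\in N_G(v)\}=\{1,\dots,\deg_G(v)\}$; (MS3) for distinct $u_1,u_2\in N_G(v)$, $\lambda(\{u_1,u_2\})<\max\{\lambda(\{u_1,v\}),\lambda(\{u_2,v\})\}$. An ordering $(v_1,\dots,v_\ell)$ of $V_G$ is an MAT-perfect elimination ordering (MAT-PEO) of $(G,\lambda)$ if for each $i\in[\ell]$, $v_i$ is MAT-simplicial in $(G_i,\lambda_i)$, where $G_i=G[\{v_1,\dots,v_i\}]$ and $\lambda_i=\lambda|_{E_{G_i}}$. *)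

theory Defs
  imports Main
begin

text \<open>A graph is given by a vertex set and a set of edges, each edge being the unordered pair of
  its end vertices.\<close>

definition finite_simple_graph :: "'a set \<Rightarrow> 'a set set \<Rightarrow> bool" where
  "finite_simple_graph V E \<longleftrightarrow> finite V \<and> (\<forall>e\<in>E. e \<subseteq> V \<and> card e = 2)"

definition edge_labeled_graph :: "'a set \<Rightarrow> 'a set set \<Rightarrow> ('a set \<Rightarrow> nat) \<Rightarrow> bool" where
  "edge_labeled_graph V E lam \<longleftrightarrow> finite_simple_graph V E \<and> (\<forall>e\<in>E. lam e > 0)"

definition neighbors :: "'a set set \<Rightarrow> 'a \<Rightarrow> 'a set" where
  "neighbors E v = {u. {u, v} \<in> E}"

definition vdegree :: "'a set set \<Rightarrow> 'a \<Rightarrow> nat" where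
  "vdegree E v = card (neighbors E v)"

definition is_clique :: "'a set set \<Rightarrow> 'a set \<Rightarrow> bool" where
  "is_clique E S \<longleftrightarrow> (\<forall>u\<in>S. \<forall>w\<in>S. u \<noteq> w \<longrightarrow> {u, w} \<in> E)"

definition induced_edges :: "'a set set \<Rightarrow> 'a set \<Rightarrow> 'a set set" where
  "induced_edges E S = {e \<in> E. e \<subseteq> S}"

definition is_path :: "'a set set \<Rightarrow> 'a list \<Rightarrow> bool" where
  "is_path F vs \<longleftrightarrow> vs \<noteq> [] \<and> distinct vs \<and> successively (\<lambda>u w. {u, w} \<in> F) vs"

definition is_cycle :: "'a set set \<Rightarrow> 'a list \<Rightarrow> bool" where
  "is_cycle F vs \<longleftrightarrow> length vs \<ge> 3 \<and> is_path F vs \<and> {last vs, hd vs} \<in> F"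

definition is_forest :: "'a set set \<Rightarrow> bool" where
  "is_forest F \<longleftrightarrow> (\<nexists>vs. is_cycle F vs)"

definition edge_closure :: "'a set set \<Rightarrow> 'a set set \<Rightarrow> 'a set set" where
  "edge_closure E F = {e \<in> E. \<exists>vs. is_path F vs \<and> e = {hd vs, last vs}}"

definition label_class :: "'a set set \<Rightarrow> ('a set \<Rightarrow> nat) \<Rightarrow> nat \<Rightarrow> 'a set set" where
  "label_class E lam k = {e \<in> E. lam e = k}"

definition label_upto :: "'a set set \<Rightarrow> ('a set \<Rightarrow> nat) \<Rightarrow> nat \<Rightarrow> 'a set set" where
  "label_upto E lam k = (\<Union>j\<in>{1..k}. label_class E lam j)"

definition mat_labeling :: "'a set \<Rightarrow> 'a set set \<Rightarrow> ('a set \<Rightarrow> nat) \<Rightarrow> bool" where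
  "mat_labeling V E lam \<longleftrightarrow>
    (\<forall>k\<ge>1.
      is_forest (label_class E lam k) \<and>
      edge_closure E (label_class E lam k) \<inter> label_upto E lam (k - 1) = {} \<and>
      (\<forall>u u'. {u, u'} \<in> label_class E lam k \<longrightarrow>
        card {w \<in> V. {u, w} \<in> label_upto E lam (k - 1) \<and> {u', w} \<in> label_upto E lam (k - 1)}
          = k - 1))"

definition mat_simplicial :: "'a set \<Rightarrow> 'a set set \<Rightarrow> ('a set \<Rightarrow> nat) \<Rightarrow> 'a \<Rightarrow> bool" where
  "mat_simplicial V E lam v \<longleftrightarrow>
    v \<in> V \<and>
    is_clique E (neighbors E v) \<and>
    (\<lambda>u. lam {u, v}) ` neighbors E v = {1..vdegree E v} \<and>
    (\<forall>u1\<in>neighbors E v. \<forall>u2\<in>neighbors E v. u1 \<noteq> u2 \<longrightarrow>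
      lam {u1, u2} < max (lam {u1, v}) (lam {u2, v}))"

text \<open>The labeling of the induced subgraph is not restricted explicitly: the clique condition
  makes every argument of the labeling in \<^const>\<open>mat_simplicial\<close> an edge of the graph concerned.\<close>

definition mat_peo :: "'a set \<Rightarrow> 'a set set \<Rightarrow> ('a set \<Rightarrow> nat) \<Rightarrow> 'a list \<Rightarrow> bool" where
  "mat_peo V E lam vs \<longleftrightarrow>
    distinct vs \<and> set vs = V \<and>
    (\<forall>i\<in>{1..length vs}.
      mat_simplicial (set (take i vs)) (induced_edges E (set (take i vs))) lam (vs ! (i - 1)))"

end

theory Submission
  imports Defs
begin

text \<open>For an edge \<open>{u, u'}\<close> of an MAT-labeled graph let \<open>W\<close> be the set of common neighbors that
  (ML3) counts. The key to the hard direction is a strengthening that lends itself to induction on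
  the number of vertices and edges: every clique \<open>K \<noteq> V\<close> that contains \<open>W\<close> for each of its edges
  misses some MAT-simplicial vertex. By induction the graphs formed by the edges of label below a
  given bound are chordal, hence every \<open>W\<close> is a clique, and the labels from \<open>u\<close> to \<open>W\<close> are exactly
  \<open>1, \<dots>, k - 1\<close> if \<open>{u, u'}\<close> has label \<open>k\<close>. If \<open>k\<close> is the maximal label, then removing \<open>W\<close> and the
  edge \<open>{u, u'}\<close> separates \<open>u\<close> from \<open>u'\<close>. The side of \<open>u\<close> is either \<open>{u}\<close>, and then \<open>u\<close> is
  MAT-simplicial, or by induction it contains an MAT-simplicial vertex outside the clique
  \<open>W \<union> {u}\<close>. Since \<open>K\<close> can meet both sides only in \<open>u\<close> and \<open>u'\<close>, one of the two sides provides a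
  vertex outside \<open>K\<close>.\<close>

section \<open>Paths and forests\<close>

lemma is_path_mono: "is_path F vs \<Longrightarrow> F \<subseteq> F' \<Longrightarrow> is_path F' vs"
  unfolding is_path_def by (auto elim!: successively_mono)

lemma is_forest_mono: "is_forest F' \<Longrightarrow> F \<subseteq> F' \<Longrightarrow> is_forest F"
  unfolding is_forest_def is_cycle_def using is_path_mono by blast

lemma is_path_rev: "is_path F vs \<Longrightarrow> is_path F (rev vs)"
  unfolding is_path_def by (auto simp: insert_commute)

lemma is_path_Cons:
  "ys \<noteq> [] \<Longrightarrow> is_path F (v # ys) \<longleftrightarrow> v \<notin> set ys \<and> {v, hd ys} \<in> F \<and> is_path F ys"
  unfolding is_path_def by (cases ys) auto

lemma is_path_append:
  "xs \<noteq> [] \<Longrightarrow> ys \<noteq> [] \<Longrightarrow> is_path F (xs @ ys) \<longleftrightarrow>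
    set xs \<inter> set ys = {} \<and> {last xs, hd ys} \<in> F \<and> is_path F xs \<and> is_path F ys"
  unfolding is_path_def by (auto simp: successively_append_iff)

lemma is_path_restrict:
  assumes "is_path F vs" "set vs \<subseteq> S"
  shows "is_path {e \<in> F. e \<subseteq> S} vs"
proof -
  have "successively (\<lambda>u w. {u, w} \<in> {e \<in> F. e \<subseteq> S}) vs"
  proof (rule successively_mono)
    show "successively (\<lambda>u w. {u, w} \<in> F) vs" using assms(1) by (simp add: is_path_def)
  next
    fix x y assume "x \<in> set vs" "y \<in> set vs" "{x, y} \<in> F"
    then show "{x, y} \<in> {e \<in> F. e \<subseteq> S}" using assms(2) by auto
  qed
  then show ?thesis using assms(1) by (simp add: is_path_def)
qed

text \<open>This is applied to a vertex that meets at most one edge of \<open>F\<close>: such a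
  vertex can occur only at an end of a path.\<close>

lemma is_path_interior_neighbors:
  assumes "is_path F vs" "v \<in> set vs" "v \<noteq> hd vs" "v \<noteq> last vs"
  obtains a b where "a \<noteq> b" "{a, v} \<in> F" "{b, v} \<in> F"
proof -
  obtain xs ys where vs: "vs = xs @ v # ys" using assms(2) by (meson split_list)
  have ne: "xs \<noteq> []" "ys \<noteq> []" using assms(3,4) vs by auto
  have p: "set xs \<inter> set (v # ys) = {}" "{last xs, v} \<in> F" "is_path F (v # ys)"
    using assms(1) ne unfolding vs by (simp_all add: is_path_append)
  have "{v, hd ys} \<in> F" using p(3) ne by (simp add: is_path_Cons)
  moreover have "last xs \<noteq> hd ys" using p(1) ne by (metis disjoint_iff hd_in_set last_in_set list.set_intros(2))
  ultimately show ?thesis using that p(2) by (simp add: insert_commute)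
qed

text \<open>A vertex at an end of the list gets its second neighbor from the closing edge; having at
  least three vertices keeps the two neighbors distinct.\<close>

lemma is_cycle_neighbors:
  assumes "is_cycle F vs" "v \<in> set vs"
  obtains a b where "a \<noteq> b" "{a, v} \<in> F" "{b, v} \<in> F"
proof -
  have len: "length vs \<ge> 3" and p: "is_path F vs" and c: "{last vs, hd vs} \<in> F"
    using assms(1) unfolding is_cycle_def by auto
  consider "v \<noteq> hd vs \<and> v \<noteq> last vs" | "v = hd vs" | "v = last vs" by blast
  then show ?thesis
  proof cases
    case 1
    then show ?thesis using is_path_interior_neighbors[OF p assms(2)] that by metis
  next
    case 2
    then obtain ys where vs: "vs = v # ys" using assms(2) by (cases vs) auto
    then obtain a zs where ys: "ys = a # zs" "zs \<noteq> []" using len by (cases ys) force+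
    have "{v, a} \<in> F" "a \<notin> set zs" using p ys vs by (simp_all add: is_path_Cons)
    moreover have "{last zs, v} \<in> F" using c ys vs by simp
    ultimately show ?thesis using that[of a "last zs"] ys(2) by (metis insert_commute last_in_set)
  next
    case 3
    then obtain ys where vs: "rev vs = v # ys"
      using assms(2) by (metis hd_rev list.exhaust_sel rev_is_Nil_conv set_empty empty_iff)
    have "length ys \<ge> 2" using len vs by (metis Suc_le_mono length_Cons length_rev numeral_2_eq_2 numeral_3_eq_3)
    then obtain a zs where ys: "ys = a # zs" "zs \<noteq> []" by (cases ys) force+
    have "{v, a} \<in> F" "a \<notin> set zs" using is_path_rev[OF p] ys vs by (simp_all add: is_path_Cons)
    moreover have "hd vs = last zs" using vs ys by (metis last_ConsR last_rev list.distinct(1) rev_is_Nil_conv)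
    then have "{v, last zs} \<in> F" using c 3 by simp
    ultimately show ?thesis using that[of a "last zs"] ys(2) by (metis insert_commute last_in_set)
  qed
qed

lemma rtrancl_imp_is_path:
  assumes "(a, b) \<in> {(x, y). {x, y} \<in> F}\<^sup>*"
  shows "\<exists>vs. is_path F vs \<and> hd vs = a \<and> last vs = b"
  using assms
proof (induction rule: converse_rtrancl_induct)
  case base
  have "is_path F [b]" by (simp add: is_path_def)
  then show ?case by force
next
  case (step a c)
  then obtain vs where vs: "is_path F vs" "hd vs = c" "last vs = b" by blast
  have ne: "vs \<noteq> []" using vs(1) by (simp add: is_path_def)
  show ?case
  proof (cases "a \<in> set vs")
    case True
    \<comment> \<open>The walk returns to a vertex of the path, so the part before this vertex is
      cut off.\<close>
    then obtain xs ys where s: "vs = xs @ a # ys" by (meson split_list)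
    then have "is_path F (a # ys)" using vs(1) by (cases "xs = []") (auto simp: is_path_append)
    then show ?thesis using s vs(3) by (intro exI[of _ "a # ys"]) auto
  next
    case False
    then have "is_path F (a # vs)" using step.hyps(1) vs ne by (simp add: is_path_Cons)
    then show ?thesis using ne vs(3) by (intro exI[of _ "a # vs"]) auto
  qed
qed

lemma is_forest_edge_separates:
  assumes "is_forest F" "{u, u'} \<in> F" "u \<noteq> u'"
  shows "(u, u') \<notin> {(x, y). {x, y} \<in> F - {{u, u'}}}\<^sup>*"
proof
  assume "(u, u') \<in> {(x, y). {x, y} \<in> F - {{u, u'}}}\<^sup>*"
  from rtrancl_imp_is_path[OF this]
  obtain vs where vs: "is_path (F - {{u, u'}}) vs" "hd vs = u" "last vs = u'" by blast
  obtain xs where xs: "vs = u # xs" using vs by (metis is_path_def list.collapse)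
  have "xs \<noteq> []" using xs vs(3) assms(3) by auto
  then obtain a ys where ys: "xs = a # ys" by (cases xs) auto
  \<comment> \<open>A path with only two vertices would be the deleted edge itself.\<close>
  have "ys \<noteq> []"
    using vs xs ys by (auto simp: is_path_def)
  then have "length vs \<ge> 3" using xs ys by (cases ys) auto
  moreover have "is_path F vs" using vs(1) is_path_mono by blast
  ultimately have "is_cycle F vs" using vs assms(2) by (simp add: is_cycle_def insert_commute)
  then show False using assms(1) by (auto simp: is_forest_def)
qed

section \<open>MAT-labelings\<close>

lemma is_cliqueD: "is_clique E Q \<Longrightarrow> x \<in> Q \<Longrightarrow> y \<in> Q \<Longrightarrow> x \<noteq> y \<Longrightarrow> {x, y} \<in> E"
  unfolding is_clique_def by simp

text \<open>For an edge this is the set counted in (ML3), with membership in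
  \<open>label_upto\<close> expressed by comparing labels, so that neither \<open>V\<close> nor the
  index \<open>k\<close> appears.\<close>

definition lower_common_neighbors ::
  "'a set set \<Rightarrow> ('a set \<Rightarrow> nat) \<Rightarrow> 'a \<Rightarrow> 'a \<Rightarrow> 'a set" where
  "lower_common_neighbors E lam u u' =
    {w. {u, w} \<in> E \<and> {u', w} \<in> E \<and> lam {u, w} < lam {u, u'} \<and> lam {u', w} < lam {u, u'}}"

text \<open>This is the condition under which the counts of (ML3) stay the same in the subgraph
  induced by \<open>K\<close>.\<close>

definition label_closed :: "'a set set \<Rightarrow> ('a set \<Rightarrow> nat) \<Rightarrow> 'a set \<Rightarrow> bool" where
  "label_closed E lam K \<longleftrightarrow>
    (\<forall>x\<in>K. \<forall>y\<in>K. {x, y} \<in> E \<longrightarrow> lower_common_neighbors E lam x y \<subseteq> K)"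

lemma lower_common_neighbors_commute:
  "lower_common_neighbors E lam u u' = lower_common_neighbors E lam u' u"
  unfolding lower_common_neighbors_def by (auto simp: insert_commute)

lemma edge_labeled_graphD:
  assumes "edge_labeled_graph V E lam"
  shows "finite V" "finite E" "e \<in> E \<Longrightarrow> e \<subseteq> V" "e \<in> E \<Longrightarrow> 0 < lam e"
    "{a, b} \<in> E \<Longrightarrow> a \<in> V" "{a, b} \<in> E \<Longrightarrow> b \<in> V" "{a, b} \<in> E \<Longrightarrow> a \<noteq> b"
    "{a, a} \<notin> E"
proof -
  show f: "finite V" and s: "e \<in> E \<Longrightarrow> e \<subseteq> V" and "e \<in> E \<Longrightarrow> 0 < lam e" for e
    using assms unfolding edge_labeled_graph_def finite_simple_graph_def by auto
  show "finite E" using f s by (meson PowI finite_Pow_iff finite_subset subsetI)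
  show "{a, b} \<in> E \<Longrightarrow> a \<in> V" "{a, b} \<in> E \<Longrightarrow> b \<in> V" using s by blast+
  show "{a, b} \<in> E \<Longrightarrow> a \<noteq> b" "{a, a} \<notin> E"
    using assms unfolding edge_labeled_graph_def finite_simple_graph_def by fastforce+
qed

lemma edge_obtain_pair:
  assumes "edge_labeled_graph V E lam" "e \<in> E"
  obtains a b where "e = {a, b}" "a \<noteq> b"
  using assms unfolding edge_labeled_graph_def finite_simple_graph_def by (meson card_2_iff)

lemma edge_labeled_graph_induced:
  "edge_labeled_graph V E lam \<Longrightarrow> finite S \<Longrightarrow> edge_labeled_graph S (induced_edges E S) lam"
  unfolding edge_labeled_graph_def finite_simple_graph_def induced_edges_def by auto

lemma edge_labeled_graph_subset:
  "edge_labeled_graph V E lam \<Longrightarrow> F \<subseteq> E \<Longrightarrow> edge_labeled_graph V F lam"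
  unfolding edge_labeled_graph_def finite_simple_graph_def by auto

lemma mat_labeling_iff:
  assumes G: "edge_labeled_graph V E lam"
  shows "mat_labeling V E lam \<longleftrightarrow>
    (\<forall>k. is_forest (label_class E lam k)) \<and>
    (\<forall>k vs. is_path (label_class E lam k) vs \<longrightarrow> {hd vs, last vs} \<in> E \<longrightarrow> k \<le> lam {hd vs, last vs}) \<and>
    (\<forall>u u'. {u, u'} \<in> E \<longrightarrow> card (lower_common_neighbors E lam u u') = lam {u, u'} - 1)"
    (is "_ \<longleftrightarrow> ?F \<and> ?P \<and> ?C")
proof -
  note g = edge_labeled_graphD[OF G]
  have up: "label_upto E lam (k - 1) = {e \<in> E. lam e < k}" if "k \<ge> 1" for k
    using g(4) that unfolding label_upto_def label_class_def by (force simp: Suc_le_eq)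
  have zero: "label_class E lam 0 = {}" using g(4) unfolding label_class_def by auto
  have F: "?F \<longleftrightarrow> (\<forall>k\<ge>1. is_forest (label_class E lam k))"
  proof -
    have "is_forest ({} :: 'a set set)" by (auto simp: is_forest_def is_cycle_def)
    then show ?thesis using zero by (metis less_one not_le)
  qed
  have P: "?P \<longleftrightarrow>
      (\<forall>k\<ge>1. edge_closure E (label_class E lam k) \<inter> label_upto E lam (k - 1) = {})"
    (is "_ \<longleftrightarrow> ?P'")
  proof
    assume ?P
    then show ?P' using up by (fastforce simp: edge_closure_def)
  next
    assume p: ?P'
    show ?P
    proof (intro allI impI)
      fix k vs assume a: "is_path (label_class E lam k) vs" "{hd vs, last vs} \<in> E"
      show "k \<le> lam {hd vs, last vs}"
      proof (cases "k \<ge> 1")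
        case True
        have "{hd vs, last vs} \<in> edge_closure E (label_class E lam k)"
          using a unfolding edge_closure_def by blast
        then show ?thesis using p up[OF True] True a(2) by fastforce
      qed simp
    qed
  qed
  have set_eq: "{w \<in> V. {u, w} \<in> label_upto E lam (lam {u, u'} - 1) \<and>
        {u', w} \<in> label_upto E lam (lam {u, u'} - 1)} = lower_common_neighbors E lam u u'"
    if "{u, u'} \<in> E" for u u'
    using up[of "lam {u, u'}"] g that unfolding lower_common_neighbors_def
    by (auto simp: Suc_le_eq)
  have C: "?C \<longleftrightarrow> (\<forall>k\<ge>1. \<forall>u u'. {u, u'} \<in> label_class E lam k \<longrightarrow>
        card {w \<in> V. {u, w} \<in> label_upto E lam (k - 1) \<and> {u', w} \<in> label_upto E lam (k - 1)}
          = k - 1)"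
    (is "_ \<longleftrightarrow> ?C'")
  proof
    assume ?C
    then show ?C' using set_eq unfolding label_class_def by auto
  next
    assume c: ?C'
    show ?C
    proof (intro allI impI)
      fix u u' assume e: "{u, u'} \<in> E"
      then have "1 \<le> lam {u, u'}" "{u, u'} \<in> label_class E lam (lam {u, u'})"
        using g(4) unfolding label_class_def by (auto simp: Suc_le_eq)
      from c[rule_format, OF this]
      show "card (lower_common_neighbors E lam u u') = lam {u, u'} - 1"
        unfolding set_eq[OF e] .
    qed
  qed
  show ?thesis unfolding F P C mat_labeling_def by blast
qed

locale mat_graph =
  fixes V :: "'a set" and E :: "'a set set" and lam :: "'a set \<Rightarrow> nat"
  assumes graph: "edge_labeled_graph V E lam"
    and mat: "mat_labeling V E lam"
begin

lemmas graphD = edge_labeled_graphD[OF graph]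

abbreviation "base \<equiv> lower_common_neighbors E lam"

lemma forest: "is_forest (label_class E lam k)"
  and path_label: "is_path (label_class E lam k) vs \<Longrightarrow> {hd vs, last vs} \<in> E \<Longrightarrow>
        k \<le> lam {hd vs, last vs}"
  and card_base: "{u, u'} \<in> E \<Longrightarrow> card (base u u') = lam {u, u'} - 1"
  using mat unfolding mat_labeling_iff[OF graph] by blast+

lemma base_subset: "base u u' \<subseteq> V"
  using graphD unfolding lower_common_neighbors_def by auto

lemma finite_base: "finite (base u u')"
  using base_subset graphD(1) finite_subset by blast

text \<open>The two edges at \<open>a\<close> form a path with constant label, so (ML2) gives the
  weak inequality; equality would create a triangle within one label class, against (ML1).\<close>

lemma triangle:
  assumes "{a, b} \<in> E" "{a, c} \<in> E" "{b, c} \<in> E" "lam {a, b} = lam {a, c}"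
  shows "lam {a, b} < lam {b, c}"
proof -
  let ?F = "label_class E lam (lam {a, b})"
  have d: "a \<noteq> b" "a \<noteq> c" "b \<noteq> c" using assms graphD(7) by blast+
  have p: "is_path ?F [b, a, c]"
    using d assms by (auto simp: is_path_def label_class_def insert_commute)
  have "lam {a, b} \<le> lam {b, c}" using path_label[OF p] assms by simp
  moreover have "lam {a, b} \<noteq> lam {b, c}"
  proof
    assume "lam {a, b} = lam {b, c}"
    then have "is_cycle ?F [b, a, c]"
      using p assms by (auto simp: is_cycle_def label_class_def insert_commute)
    then show False using forest unfolding is_forest_def by blast
  qed
  ultimately show ?thesis by simp
qed

text \<open>In a triangle the largest label occurs only once, since two equal labels force a larger
  third one.\<close>

lemma max_label_base:
  assumes "{a, b} \<in> E" "{a, c} \<in> E" "{b, c} \<in> E"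
    "lam {a, c} \<le> lam {a, b}" "lam {b, c} \<le> lam {a, b}"
  shows "c \<in> base a b"
proof -
  have "{b, a} \<in> E" using assms(1) by (simp add: insert_commute)
  then have "lam {a, c} \<noteq> lam {a, b}" "lam {b, c} \<noteq> lam {a, b}"
    using assms triangle[of a b c] triangle[of b a c] by (auto simp: insert_commute[of b a])
  then show ?thesis using assms unfolding lower_common_neighbors_def by simp
qed

section \<open>Subgraphs that inherit an MAT-labeling\<close>

lemma mat_graph_restrict:
  assumes S: "S \<subseteq> V" "label_closed E lam S"
  shows "mat_graph S (induced_edges E S) lam"
proof -
  let ?E = "induced_edges E S"
  have g: "edge_labeled_graph S ?E lam"
    using edge_labeled_graph_induced graph S(1) graphD(1) finite_subset by blast
  have sub: "label_class ?E lam k \<subseteq> label_class E lam k" for k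
    unfolding label_class_def induced_edges_def by blast
  have EE: "?E \<subseteq> E" unfolding induced_edges_def by blast
  have "lower_common_neighbors ?E lam u u' = base u u'" if "{u, u'} \<in> ?E" for u u'
    using that S(2) unfolding lower_common_neighbors_def induced_edges_def label_closed_def by blast
  then have "mat_labeling S ?E lam" unfolding mat_labeling_iff[OF g]
    using is_forest_mono[OF forest sub] is_path_mono[OF _ sub] path_label card_base EE by auto
  then show ?thesis using g by unfold_locales
qed

text \<open>The base of an edge involves only edges of smaller label, so dropping the large labels
  changes no base of a remaining edge.\<close>

lemma mat_graph_truncate: "mat_graph V {e \<in> E. lam e < m} lam"
proof -
  let ?E = "{e \<in> E. lam e < m}"
  have g: "edge_labeled_graph V ?E lam" by (rule edge_labeled_graph_subset[OF graph]) blast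
  have sub: "label_class ?E lam k \<subseteq> label_class E lam k" for k
    unfolding label_class_def by blast
  have "lower_common_neighbors ?E lam u u' = base u u'" if "{u, u'} \<in> ?E" for u u'
    using that unfolding lower_common_neighbors_def by auto
  then have "mat_labeling V ?E lam" unfolding mat_labeling_iff[OF g]
    using is_forest_mono[OF forest sub] is_path_mono[OF _ sub] path_label card_base by auto
  then show ?thesis using g by unfold_locales
qed

text \<open>(MS3) keeps \<open>v\<close> out of the base of every edge that does not contain
  \<open>v\<close>. Hence deleting \<open>v\<close> preserves the MAT-labeling.\<close>

lemma label_closed_remove_simplicial:
  assumes "mat_simplicial V E lam v"
  shows "label_closed E lam (V - {v})"
  unfolding label_closed_def
proof (intro ballI impI subsetI)
  fix x y w assume a: "x \<in> V - {v}" "y \<in> V - {v}" "{x, y} \<in> E" "w \<in> base x y"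
  have "w \<noteq> v"
  proof
    assume w: "w = v"
    have "x \<in> neighbors E v" "y \<in> neighbors E v" "x \<noteq> y"
      using a graphD(7) unfolding w neighbors_def lower_common_neighbors_def by auto
    then have "lam {x, y} < max (lam {x, v}) (lam {y, v})"
      using assms unfolding mat_simplicial_def by blast
    then show False using a(4) unfolding w lower_common_neighbors_def by auto
  qed
  then show "w \<in> V - {v}" using a(4) base_subset by blast
qed

lemma clique_card_le:
  assumes "is_clique E Q" "finite Q" "\<And>x y. x \<in> Q \<Longrightarrow> y \<in> Q \<Longrightarrow> x \<noteq> y \<Longrightarrow> lam {x, y} \<le> m"
  shows "card Q \<le> m + 1"
  using assms(3)
proof (induction m)
  case 0
  \<comment> \<open>Labels are positive, so the bound zero excludes any edge in
    \<open>Q\<close>.\<close>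
  have "x = y" if "x \<in> Q" "y \<in> Q" for x y
    using 0 that assms(1) graphD(4) unfolding is_clique_def by (metis le_zero_eq less_irrefl)
  then have "card Q \<le> 1" using assms(2) by (simp add: card_le_Suc0_iff_eq)
  then show ?case by simp
next
  case (Suc m)
  show ?case
  proof (cases "\<exists>x\<in>Q. \<exists>y\<in>Q. x \<noteq> y \<and> lam {x, y} = Suc m")
    case True
    then obtain x y where xy: "x \<in> Q" "y \<in> Q" "x \<noteq> y" "lam {x, y} = Suc m" by blast
    have e: "{x, y} \<in> E" using xy assms(1) unfolding is_clique_def by blast
    have "Q - {x, y} \<subseteq> base x y"
    proof
      fix z assume "z \<in> Q - {x, y}"
      then have z: "z \<in> Q" "x \<noteq> z" "y \<noteq> z" by auto
      then have "{x, z} \<in> E" "{y, z} \<in> E"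
        using is_cliqueD[OF assms(1)] xy by simp_all
      moreover have "lam {x, z} \<le> lam {x, y}" "lam {y, z} \<le> lam {x, y}"
        unfolding xy(4) using Suc.prems xy z by simp_all
      ultimately show "z \<in> base x y" using max_label_base e by blast
    qed
    then have "card (Q - {x, y}) \<le> m"
      using card_mono[OF finite_base[of x y]] card_base[OF e] xy(4) by simp
    moreover have "card (Q - {x, y}) = card Q - 2"
      using xy by (simp add: card_Diff_subset)
    ultimately show ?thesis by simp
  next
    case False
    have "lam {x, y} \<le> m" if "x \<in> Q" "y \<in> Q" "x \<noteq> y" for x y
      using False Suc.prems[OF that] that by (auto simp: le_Suc_eq)
    then show ?thesis using Suc.IH by simp
  qed
qed


lemma mat_simplicial_induced_imp:
  assumes "S \<subseteq> V" "neighbors E v \<subseteq> S" "mat_simplicial S (induced_edges E S) lam v"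
  shows "mat_simplicial V E lam v"
proof -
  have v: "v \<in> S" using assms(3) unfolding mat_simplicial_def by simp
  have n: "neighbors (induced_edges E S) v = neighbors E v"
    using v assms(2) unfolding neighbors_def induced_edges_def by auto
  have "is_clique E (neighbors E v)"
    using assms(3) unfolding mat_simplicial_def n by (simp add: is_clique_def induced_edges_def)
  then show ?thesis using assms(1,3) v unfolding mat_simplicial_def vdegree_def n by blast
qed

end

section \<open>Chordality\<close>

text \<open>For finite simple graphs this is the characterization of chordality by simplicial
  vertices in all nonempty induced subgraphs. It suits an argument that eliminates vertices one by
  one.\<close>

definition chordal :: "'a set set \<Rightarrow> bool" where
  "chordal E \<longleftrightarrow> (\<forall>S. finite S \<and> S \<noteq> {} \<longrightarrow>
    (\<exists>v\<in>S. \<forall>a\<in>S. \<forall>b\<in>S. {a, v} \<in> E \<longrightarrow> {b, v} \<in> E \<longrightarrow> a \<noteq> b \<longrightarrow> {a, b} \<in> E))"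

lemma chordalD:
  assumes "chordal E" "finite S" "S \<noteq> {}"
  obtains v where "v \<in> S"
    "\<And>a b. a \<in> S \<Longrightarrow> b \<in> S \<Longrightarrow> {a, v} \<in> E \<Longrightarrow> {b, v} \<in> E \<Longrightarrow> a \<noteq> b \<Longrightarrow> {a, b} \<in> E"
  using assms unfolding chordal_def by meson

text \<open>A simplicial vertex among the four cannot be \<open>w\<close> or \<open>w'\<close>,
  which both see the nonadjacent pair \<open>u\<close>, \<open>u'\<close>. So it is \<open>u\<close>
  or \<open>u'\<close>, and its neighbors \<open>w\<close>, \<open>w'\<close> are adjacent.\<close>

lemma chordal_four_cycle:
  assumes E: "chordal E" and uw: "{u, w} \<in> E" "{u, w'} \<in> E" "{u', w} \<in> E" "{u', w'} \<in> E"
    and ne: "u \<noteq> u'" "w \<noteq> w'" and "{u, u'} \<notin> E"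
  shows "{w, w'} \<in> E"
proof -
  have sym: "{w, u} \<in> E" "{w', u} \<in> E" "{w, u'} \<in> E" "{w', u'} \<in> E"
    using uw by (simp_all add: insert_commute)
  obtain v where v: "v \<in> {u, u', w, w'}" and s: "\<And>a b. a \<in> {u, u', w, w'} \<Longrightarrow>
      b \<in> {u, u', w, w'} \<Longrightarrow> {a, v} \<in> E \<Longrightarrow> {b, v} \<in> E \<Longrightarrow> a \<noteq> b \<Longrightarrow> {a, b} \<in> E"
    using chordalD[OF E, of "{u, u', w, w'}"] by auto
  have "v = u \<or> v = u'"
    using v s[of u u'] uw ne assms(8) by auto
  then show ?thesis using s[of w w'] sym ne by auto
qed

lemma rtrancl_avoid_simplicial:
  assumes xy: "(x, y) \<in> R\<^sup>*" and "x \<noteq> z" "y \<noteq> z"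
    and sh: "\<And>a b. (a, z) \<in> R \<Longrightarrow> (z, b) \<in> R \<Longrightarrow> a \<noteq> b \<Longrightarrow> (a, b) \<in> R"
  shows "(x, y) \<in> {(a, b) \<in> R. a \<noteq> z \<and> b \<noteq> z}\<^sup>*"
proof -
  let ?R = "{(a, b) \<in> R. a \<noteq> z \<and> b \<noteq> z}"
  \<comment> \<open>The induction also has to cover walks that currently end at \<open>z\<close>.
    For these it records that every possible next vertex can be reached while bypassing
    \<open>z\<close>.\<close>
  have "(y \<noteq> z \<longrightarrow> (x, y) \<in> ?R\<^sup>*) \<and> (y = z \<longrightarrow> (\<forall>c. (z, c) \<in> R \<longrightarrow> c \<noteq> z \<longrightarrow> (x, c) \<in> ?R\<^sup>*))"
    using xy
  proof (induction rule: rtrancl_induct)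
    case base
    then show ?case using assms(2) by simp
  next
    case (step b c)
    show ?case
    proof (intro conjI impI allI)
      assume c: "c \<noteq> z"
      show "(x, c) \<in> ?R\<^sup>*"
      proof (cases "b = z")
        case True
        then show ?thesis using step c by blast
      next
        case False
        then have "(x, b) \<in> ?R\<^sup>*" "(b, c) \<in> ?R" using step c by auto
        then show ?thesis by (rule rtrancl.rtrancl_into_rtrancl)
      qed
    next
      fix d assume d: "c = z" "(z, d) \<in> R" "d \<noteq> z"
      show "(x, d) \<in> ?R\<^sup>*"
      proof (cases "b = z")
        case True
        then show ?thesis using step d by blast
      next
        case False
        then have "(x, b) \<in> ?R\<^sup>*" using step by blast
        moreover have "b = d \<or> (b, d) \<in> ?R" using sh[of b d] step d False by auto
        ultimately show ?thesis by (auto intro: rtrancl.rtrancl_into_rtrancl)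
      qed
    qed
  qed
  then show ?thesis using assms(3) by blast
qed

text \<open>The proof eliminates simplicial vertices of \<open>S\<close> one by one. A simplicial vertex in \<open>W\<close>
  would create a clique that is too large, one that equals \<open>x\<close> or \<open>y\<close> has no neighbor outside
  \<open>W\<close>, and any other one can be bypassed.\<close>

lemma chordal_complete_vertices_disconnected:
  assumes E: "chordal E" and S: "finite S" "W \<subseteq> S" "x \<in> S" "y \<in> S"
    and W: "is_clique E W" "x \<notin> W" "y \<notin> W"
    and xw: "\<And>w. w \<in> W \<Longrightarrow> {x, w} \<in> E" and yw: "\<And>w. w \<in> W \<Longrightarrow> {y, w} \<in> E"
    and bound: "\<And>a b. a \<noteq> b \<Longrightarrow> a \<notin> W \<Longrightarrow> b \<notin> W \<Longrightarrow> \<not> is_clique E (insert a (insert b W))"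
    and conn: "(x, y) \<in> {(a, b). a \<in> S - W \<and> b \<in> S - W \<and> {a, b} \<in> E}\<^sup>*"
  shows "x = y"
  using S conn
proof (induction "card S" arbitrary: S rule: less_induct)
  case less
  let ?R = "\<lambda>S. {(a, b). a \<in> S - W \<and> b \<in> S - W \<and> {a, b} \<in> E}"
  have clique: "is_clique E (insert a (insert b W))"
    if "{a, b} \<in> E" "\<And>w. w \<in> W \<Longrightarrow> {a, w} \<in> E" "\<And>w. w \<in> W \<Longrightarrow> {b, w} \<in> E" for a b
  proof -
    have "{w, a} \<in> E" "{w, b} \<in> E" if "w \<in> W" for w
      using \<open>\<And>w. w \<in> W \<Longrightarrow> {a, w} \<in> E\<close>[OF that] \<open>\<And>w. w \<in> W \<Longrightarrow> {b, w} \<in> E\<close>[OF that]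
      by (simp_all add: insert_commute)
    moreover have "{b, a} \<in> E" using that(1) by (simp add: insert_commute)
    ultimately show ?thesis using W(1) that unfolding is_clique_def by simp
  qed
  obtain z where z: "z \<in> S"
    and simp_z: "\<And>a b. a \<in> S \<Longrightarrow> b \<in> S \<Longrightarrow> {a, z} \<in> E \<Longrightarrow> {b, z} \<in> E \<Longrightarrow> a \<noteq> b \<Longrightarrow> {a, b} \<in> E"
    using chordalD[OF E less.prems(1)] less.prems(3) by blast
  \<comment> \<open>A neighbor \<open>b\<close> of \<open>z\<close> outside \<open>W\<close> would,
    by simpliciality of \<open>z\<close>, be adjacent to all of \<open>W\<close>, and
    \<open>W\<close> with \<open>z\<close> and \<open>b\<close> would be a clique excluded by
    \<open>bound\<close>.\<close>
  have isolated: "b = z" if "z \<notin> W" "\<And>w. w \<in> W \<Longrightarrow> {z, w} \<in> E" "(z, b) \<in> ?R S" for b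
  proof (rule ccontr)
    assume "b \<noteq> z"
    have "{b, w} \<in> E" if "w \<in> W" for w
      using simp_z[of b w] that \<open>\<And>w. w \<in> W \<Longrightarrow> {z, w} \<in> E\<close>[of w] \<open>(z, b) \<in> ?R S\<close> less.prems(2)
      by (auto simp: insert_commute)
    then show False using bound[of z b] clique[of z b] that \<open>b \<noteq> z\<close> by auto
  qed
  show ?case
  proof (rule ccontr)
    assume ne: "x \<noteq> y"
    have stay: "b = z" if "z \<notin> W" "\<And>w. w \<in> W \<Longrightarrow> {z, w} \<in> E" "(z, b) \<in> (?R S)\<^sup>*" for b
      using that(3)
    proof (induction rule: rtrancl_induct)
      case (step b c)
      then show ?case using isolated[OF that(1,2)] by blast
    qed simp
    have "z \<notin> W"
    proof
      assume zW: "z \<in> W"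
      have "{x, y} \<in> E" using simp_z[of x y] xw[OF zW] yw[OF zW] less.prems ne by simp
      then show False using bound[OF ne W(2,3)] clique[of x y] xw yw by blast
    qed
    moreover have "sym (?R S)" by (auto simp: sym_def insert_commute)
    then have "(y, x) \<in> (?R S)\<^sup>*" using less.prems(5) by (meson sym_rtrancl symD)
    ultimately have zx: "z \<noteq> x" "z \<noteq> y"
      using stay[of y] stay[of x] xw yw less.prems(5) ne by auto
    have "(x, y) \<in> {(a, b) \<in> ?R S. a \<noteq> z \<and> b \<noteq> z}\<^sup>*"
    proof (rule rtrancl_avoid_simplicial[OF less.prems(5)])
      show "(a, b) \<in> ?R S" if "(a, z) \<in> ?R S" "(z, b) \<in> ?R S" "a \<noteq> b" for a b
        using that simp_z[of a b] by (simp add: insert_commute[of z])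
    qed (use zx in auto)
    moreover have "{(a, b) \<in> ?R S. a \<noteq> z \<and> b \<noteq> z} = ?R (S - {z})" by auto
    ultimately have "(x, y) \<in> (?R (S - {z}))\<^sup>*" by simp
    moreover have "card (S - {z}) < card S" using z less.prems(1) by (meson card_Diff1_less)
    ultimately have "x = y"
      using less.hyps[of "S - {z}"] less.prems zx \<open>z \<notin> W\<close> by blast
    then show False using ne by simp
  qed
qed

text \<open>Delete an MAT-simplicial vertex \<open>z\<close> and use induction. A set
  \<open>S\<close> that contains \<open>z\<close> has \<open>z\<close> as a simplicial vertex by
  (MS1); any other \<open>S\<close> spans the same edges after the deletion. The assumption
  \<open>ex\<close> is what the induction in the existence theorem supplies.\<close>

lemma mat_graph_chordal:
  assumes "mat_graph V E lam"
    and ex: "\<And>V' E'. V' \<subseteq> V \<Longrightarrow> E' \<subseteq> E \<Longrightarrow> V' \<noteq> {} \<Longrightarrow> mat_graph V' E' lam \<Longrightarrow>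
      \<exists>v. mat_simplicial V' E' lam v"
  shows "chordal E"
  using assms
proof (induction "card V" arbitrary: V E rule: less_induct)
  case less
  interpret mat_graph V E lam by fact
  show ?case
  proof (cases "V = {}")
    case True
    then have "{a, b} \<notin> E" for a b using graphD(5) by blast
    then show ?thesis unfolding chordal_def by blast
  next
    case False
    then obtain z where z: "mat_simplicial V E lam z" using less.prems by blast
    then have zV: "z \<in> V" by (simp add: mat_simplicial_def)
    let ?E = "induced_edges E (V - {z})"
    have EE: "?E \<subseteq> E" by (auto simp: induced_edges_def)
    have "mat_graph (V - {z}) ?E lam"
      by (rule mat_graph_restrict) (use z label_closed_remove_simplicial in auto)
    moreover have "card (V - {z}) < card V" using zV graphD(1) by (meson card_Diff1_less)
    ultimately have ch: "chordal ?E" using less.hyps less.prems(2) EE by (meson Diff_subset order_trans)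
    show ?thesis unfolding chordal_def
    proof (intro allI impI)
      fix S :: "'a set" assume S: "finite S \<and> S \<noteq> {}"
      show "\<exists>v\<in>S. \<forall>a\<in>S. \<forall>b\<in>S. {a, v} \<in> E \<longrightarrow> {b, v} \<in> E \<longrightarrow> a \<noteq> b \<longrightarrow> {a, b} \<in> E"
      proof (cases "z \<in> S")
        case True
        have "is_clique E (neighbors E z)" using z by (simp add: mat_simplicial_def)
        then show ?thesis using True unfolding is_clique_def neighbors_def by blast
      next
        case False
        have eq: "{a, b} \<in> ?E \<longleftrightarrow> {a, b} \<in> E" if "a \<in> S" "b \<in> S" for a b
          using that False graphD(5,6) unfolding induced_edges_def by auto
        obtain v where "v \<in> S" and v: "\<And>a b. a \<in> S \<Longrightarrow> b \<in> S \<Longrightarrow> {a, v} \<in> ?E \<Longrightarrow> {b, v} \<in> ?E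
            \<Longrightarrow> a \<noteq> b \<Longrightarrow> {a, b} \<in> ?E"
          using chordalD[OF ch] S by blast
        then show ?thesis using eq by (intro bexI[of _ v]) simp_all
      qed
    qed
  qed
qed

section \<open>Separation along an edge of maximal label\<close>

text \<open>Chordality of the lower graphs is assumed here so that the structural results can be
  used inside the induction that establishes it.\<close>

locale chordal_mat_graph = mat_graph +
  assumes chordal_lower: "{u, u'} \<in> E \<Longrightarrow> chordal {e \<in> E. lam e < lam {u, u'}}"
begin

section \<open>The lower common neighbors of an edge\<close>

text \<open>Among the edges of smaller label, \<open>u\<close> and \<open>u'\<close> are not
  adjacent, so \<open>w\<close> and \<open>w'\<close> are the only possible ends of a chord of the
  four-cycle.\<close>

lemma base_clique:
  assumes "{u, u'} \<in> E" "w \<in> base u u'" "w' \<in> base u u'" "w \<noteq> w'"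
  shows "{w, w'} \<in> E" "lam {w, w'} < lam {u, u'}"
proof -
  have "{w, w'} \<in> {e \<in> E. lam e < lam {u, u'}}"
    by (rule chordal_four_cycle[OF chordal_lower[OF assms(1)], of u w w' u'])
      (use assms graphD(7) in \<open>simp_all add: lower_common_neighbors_def\<close>)
  then show "{w, w'} \<in> E" "lam {w, w'} < lam {u, u'}" by simp_all
qed

lemma insert_base_clique:
  assumes "{u, u'} \<in> E" "x \<in> insert u (base u u')" "y \<in> insert u (base u u')" "x \<noteq> y"
  shows "{x, y} \<in> E" "lam {x, y} < lam {u, u'}"
proof -
  have "{u, w} \<in> E" "lam {u, w} < lam {u, u'}" "{w, u} \<in> E" "lam {w, u} < lam {u, u'}"
    if "w \<in> base u u'" for w
    using that unfolding lower_common_neighbors_def by (simp_all add: insert_commute)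
  then show "{x, y} \<in> E" "lam {x, y} < lam {u, u'}" using assms base_clique[of u u' x y] by auto
qed

lemma base_obtain_top:
  assumes e: "{u, u'} \<in> E" and k: "lam {u, u'} > 1"
  obtains b where "b \<in> base u u'" "{u, b} \<in> E" "lam {u, b} = lam {u, u'} - 1"
    "base u b = base u u' - {b}"
proof -
  let ?k = "lam {u, u'}"
  let ?W = "base u u'"
  let ?Q = "insert u ?W"
  have u: "u \<notin> ?W" using graphD(8) unfolding lower_common_neighbors_def by simp
  have u': "u' \<notin> ?W" using graphD(8) unfolding lower_common_neighbors_def by simp
  have cl: "is_clique E ?Q" unfolding is_clique_def using insert_base_clique[OF e] by blast
  have "card ?Q = ?k" using u finite_base card_base[OF e] k by simp
  \<comment> \<open>Labels of at most \<open>?k - 2\<close> would allow only \<open>?k - 1\<close>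
    vertices in the clique, but \<open>?Q\<close> has \<open>?k\<close>. So an edge of
    \<open>?Q\<close> has label \<open>?k - 1\<close>.\<close>
  then have "\<not> (\<forall>x\<in>?Q. \<forall>y\<in>?Q. x \<noteq> y \<longrightarrow> lam {x, y} \<le> ?k - 2)"
    using clique_card_le[OF cl, of "?k - 2"] finite_base k by fastforce
  then obtain x y where xy: "x \<in> ?Q" "y \<in> ?Q" "x \<noteq> y" and l: "lam {x, y} > ?k - 2" by force
  have exy: "{x, y} \<in> E" and lxy: "lam {x, y} = ?k - 1"
    using insert_base_clique[OF e xy] l k by auto
  \<comment> \<open>If this edge lay within \<open>?W\<close>, both \<open>u\<close> and
    \<open>u'\<close> would be in its base, and their edge would have a label below
    \<open>?k - 1\<close>. So the edge contains \<open>u\<close>, and its other end is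
    \<open>b\<close>.\<close>
  have "\<not> (x \<in> ?W \<and> y \<in> ?W)"
  proof
    assume W: "x \<in> ?W \<and> y \<in> ?W"
    have "u \<in> base x y" "u' \<in> base x y"
      using W lxy by (intro max_label_base[OF exy]; auto simp: lower_common_neighbors_def insert_commute)+
    then have "?k < lam {x, y}" using base_clique(2)[OF exy] graphD(7)[OF e] by blast
    then show False using lxy by simp
  qed
  then obtain b where b: "b \<in> ?W" "{u, b} \<in> E" "lam {u, b} = ?k - 1"
  proof (cases "x = u")
    case True
    then show ?thesis using that[of y] xy exy lxy by auto
  next
    case False
    then have "y = u" using xy \<open>\<not> (x \<in> ?W \<and> y \<in> ?W)\<close> by auto
    then show ?thesis using that[of x] xy exy lxy by (auto simp: insert_commute)
  qed
  have "?W - {b} \<subseteq> base u b"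
  proof
    fix w assume "w \<in> ?W - {b}"
    then have w: "w \<in> ?W" "w \<noteq> b" "w \<noteq> u" using u by auto
    show "w \<in> base u b"
      using insert_base_clique[OF e, of u w] insert_base_clique[OF e, of b w] w b
      by (intro max_label_base) auto
  qed
  moreover have "card (?W - {b}) = card (base u b)"
    using card_base[OF b(2)] card_base[OF e] b finite_base by simp
  ultimately have "base u b = ?W - {b}" using finite_base card_subset_eq by metis
  then show ?thesis using b that by blast
qed

text \<open>Induction descends from \<open>{u, u'}\<close> to the edge \<open>{u, b}\<close> of
  label one less, whose base is the old one without \<open>b\<close>. Putting \<open>b\<close> back
  adds exactly the next label.\<close>

lemma base_structure:
  assumes "{u, u'} \<in> E"
  shows "(\<lambda>w. lam {u, w}) ` base u u' = {1..<lam {u, u'}} \<and>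
    (\<forall>w\<in>base u u'. \<forall>w'\<in>base u u'. w \<noteq> w' \<longrightarrow> lam {w, w'} < max (lam {u, w}) (lam {u, w'})) \<and>
    label_closed E lam (insert u (base u u'))"
  using assms
proof (induction "lam {u, u'}" arbitrary: u u' rule: less_induct)
  case less
  let ?k = "lam {u, u'}"
  let ?W = "base u u'"
  show ?case
  proof (cases "?k > 1")
    case False
    then have "?W = {}" "?k = 1"
      using card_base[OF less.prems] finite_base graphD(4)[OF less.prems] by auto
    then show ?thesis using graphD(8) by (simp add: label_closed_def)
  next
    case True
    obtain b where b: "b \<in> ?W" "{u, b} \<in> E" "lam {u, b} = ?k - 1" "base u b = ?W - {b}"
      using base_obtain_top[OF less.prems True] by blast
    have bu: "{b, u} = {u, b}" by (rule insert_commute)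
    have W: "?W = insert b (base u b)" using b by blast
    have ne: "u \<noteq> b" "b \<notin> base u b" using graphD(7) b by auto
    have lt: "lam {u, b} < ?k" using b(3) True by simp
    have IH: "(\<lambda>w. lam {u, w}) ` base u b = {1..<?k - 1}"
      "\<And>w w'. w \<in> base u b \<Longrightarrow> w' \<in> base u b \<Longrightarrow> w \<noteq> w' \<Longrightarrow>
        lam {w, w'} < max (lam {u, w}) (lam {u, w'})"
      "label_closed E lam (insert u (base u b))"
      using less.hyps[OF lt b(2)] b(3) by simp_all
    \<comment> \<open>The induction hypothesis is used a second time with the roles of
      \<open>u\<close> and \<open>b\<close> exchanged, to handle pairs that contain
      \<open>b\<close>. The pair \<open>u\<close>, \<open>b\<close> itself is covered by the
      description of its base.\<close>
    have IH': "label_closed E lam (insert b (base u b))"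
      using less.hyps[of b u] lt b(2) lower_common_neighbors_commute[of E lam b u] unfolding bu by simp
    have "(\<lambda>w. lam {u, w}) ` ?W = {1..<?k}"
      unfolding W image_insert IH(1) b(3) using True by auto
    moreover have "lam {w, w'} < max (lam {u, w}) (lam {u, w'})"
      if w: "w \<in> ?W" "w' \<in> ?W" "w \<noteq> w'" for w w'
    proof -
      have lb: "lam {b, v} < lam {u, b}" "lam {v, b} < lam {u, b}" if "v \<in> base u b" for v
        using that unfolding lower_common_neighbors_def by (simp_all add: insert_commute)
      consider "w \<in> base u b" "w' \<in> base u b" | "w = b" "w' \<in> base u b" | "w \<in> base u b" "w' = b"
        using w W by auto
      then show ?thesis using IH(2) w(3) lb by cases (auto simp: less_max_iff_disj)
    qed
    moreover have "label_closed E lam (insert u ?W)"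
      unfolding label_closed_def
    proof (intro ballI impI)
      fix x y assume xy: "x \<in> insert u ?W" "y \<in> insert u ?W" "{x, y} \<in> E"
      have xny: "x \<noteq> y" using graphD(7) xy(3) by blast
      consider "x \<in> insert u (base u b)" "y \<in> insert u (base u b)"
        | "x \<in> insert b (base u b)" "y \<in> insert b (base u b)"
        | "x = u" "y = b" | "x = b" "y = u"
        using xy W xny by auto
      then show "base x y \<subseteq> insert u ?W"
      proof cases
        case 1
        then show ?thesis using IH(3) xy(3) W unfolding label_closed_def by blast
      next
        case 2
        then show ?thesis using IH' xy(3) W unfolding label_closed_def by blast
      next
        case 3
        then show ?thesis using W by auto
      next
        case 4
        then show ?thesis using W lower_common_neighbors_commute[of E lam b u] by auto
      qed
    qed
    ultimately show ?thesis by blast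
  qed
qed

text \<open>The base contributes the labels below \<open>lam {u, u'}\<close> and \<open>u'\<close>
  contributes the last one, which gives (MS2). For (MS3), pairs containing \<open>u'\<close> are
  covered by the definition of the base, all others by \<open>base_structure\<close>.\<close>

lemma mat_simplicial_edge_end:
  assumes e: "{u, u'} \<in> E" and n: "neighbors E u = insert u' (base u u')"
  shows "mat_simplicial V E lam u"
proof -
  let ?k = "lam {u, u'}"
  let ?W = "base u u'"
  have u': "u' \<notin> ?W" using graphD(8) unfolding lower_common_neighbors_def by simp
  have kpos: "?k > 0" using graphD(4) e by blast
  have W: "{u', w} \<in> E" "lam {u', w} < ?k" if "w \<in> ?W" for w
    using that unfolding lower_common_neighbors_def by simp_all
  have W': "{w, u'} \<in> E" "lam {w, u'} < ?k" if "w \<in> ?W" for w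
    using W[OF that] by (simp_all add: insert_commute)
  have flip: "{w, u} = {u, w}" for w by (rule insert_commute)
  have "is_clique E (insert u' ?W)"
    using base_clique[OF e] W W' unfolding is_clique_def by simp
  moreover have "vdegree E u = ?k"
    unfolding vdegree_def n using u' finite_base card_base[OF e] kpos by simp
  moreover have "(\<lambda>w. lam {w, u}) ` insert u' ?W = {1..?k}"
    unfolding flip image_insert using base_structure[OF e] kpos by auto
  moreover have "lam {w, w'} < max (lam {w, u}) (lam {w', u})"
    if "w \<in> insert u' ?W" "w' \<in> insert u' ?W" "w \<noteq> w'" for w w'
    unfolding flip using that base_structure[OF e] W W' by (auto simp: less_max_iff_disj)
  ultimately show ?thesis
    unfolding mat_simplicial_def n using graphD(5)[OF e] by simp
qed


text \<open>A component of the graph of labels below the maximum, with \<open>base u u'\<close> removed, contains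
  at most one vertex complete to \<open>base u u'\<close>, and edges of maximal label between different
  components join such vertices. So these edges connect the components like a forest, and
  deleting \<open>{u, u'}\<close> separates \<open>u\<close> from \<open>u'\<close>.\<close>

lemma max_edge_separates:
  assumes e: "{u, u'} \<in> E" and max: "\<And>f. f \<in> E \<Longrightarrow> lam f \<le> lam {u, u'}"
  obtains A where "u \<in> A" "u' \<notin> A" "A \<subseteq> V - base u u'"
    "\<And>a c. a \<in> A \<Longrightarrow> {a, c} \<in> E \<Longrightarrow> c \<notin> base u u' \<Longrightarrow> c \<in> A \<or> (a = u \<and> c = u')"
proof -
  define k where "k = lam {u, u'}"
  define W where "W = base u u'"
  define E' where "E' = {f \<in> E. lam f < k}"
  \<comment> \<open>\<open>R\<close> moves within a component, \<open>D\<close> consists of the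
    vertices complete to \<open>W\<close>, and \<open>T\<close> uses the other edges of maximal
    label between them. In \<open>A\<close> all \<open>T\<close>-steps may come before the
    \<open>R\<close>-steps, because a component has at most one vertex in \<open>D\<close>.\<close>
  define R where "R = {(a, b). a \<in> V - W \<and> b \<in> V - W \<and> {a, b} \<in> E'}"
  define D where "D = {x \<in> V - W. \<forall>w\<in>W. {x, w} \<in> E'}"
  define F where "F = label_class E lam k"
  define T where "T = {(a, b). a \<in> D \<and> b \<in> D \<and> {a, b} \<in> F - {{u, u'}}}"
  define A where "A = {b. \<exists>x\<in>D. (u, x) \<in> T\<^sup>* \<and> (x, b) \<in> R\<^sup>*}"
  have kpos: "k > 0" unfolding k_def using graphD(4) e by blast
  have cW: "card W = k - 1" unfolding W_def k_def by (rule card_base[OF e])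
  have finW: "finite W" unfolding W_def by (rule finite_base)
  have WV: "W \<subseteq> V" unfolding W_def by (rule base_subset)
  have clW: "is_clique E' W"
    using base_clique[OF e] unfolding is_clique_def W_def E'_def k_def by simp
  \<comment> \<open>Such a clique would have \<open>k + 1\<close> vertices, while labels of at most
    \<open>k - 1\<close> allow only \<open>k\<close>.\<close>
  have bound: "\<not> is_clique E' (insert a (insert b W))" if "a \<noteq> b" "a \<notin> W" "b \<notin> W" for a b
  proof
    let ?Q = "insert a (insert b W)"
    assume c: "is_clique E' ?Q"
    then have "is_clique E ?Q" unfolding is_clique_def E'_def by simp
    moreover have "lam {x, y} \<le> k - 1" if "x \<in> ?Q" "y \<in> ?Q" "x \<noteq> y" for x y
      using is_cliqueD[OF c that] unfolding E'_def by auto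
    ultimately have "card ?Q \<le> k - 1 + 1" using clique_card_le finW by blast
    moreover have "card ?Q = k + 1" using that finW cW kpos by simp
    ultimately show False using kpos by simp
  qed
  have unique: "x = y" if "x \<in> D" "y \<in> D" "(x, y) \<in> R\<^sup>*" for x y
    by (rule chordal_complete_vertices_disconnected[of E' V W])
      (use chordal_lower[OF e] graphD(1) WV clW bound that in
        \<open>auto simp: R_def D_def E'_def k_def\<close>)
  have uD: "u \<in> D" "u' \<in> D"
    using graphD(5,6)[OF e] graphD(8) unfolding D_def W_def E'_def k_def lower_common_neighbors_def
    by auto
  have "u' \<notin> A"
  proof
    assume "u' \<in> A"
    then obtain x where x: "x \<in> D" "(u, x) \<in> T\<^sup>*" "(x, u') \<in> R\<^sup>*" unfolding A_def by blast
    \<comment> \<open>Both vertices lie in \<open>D\<close> and in one component, so reaching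
      \<open>u'\<close> would take edges of \<open>F - {{u, u'}}\<close> alone, which the forest
      condition excludes.\<close>
    have "x = u'" using unique x uD by blast
    then have uT: "(u, u') \<in> T\<^sup>*" using x by simp
    have "T \<subseteq> {(x, y). {x, y} \<in> F - {{u, u'}}}" unfolding T_def by auto
    note uF = subsetD[OF rtrancl_mono[OF this] uT]
    have "is_forest F" unfolding F_def by (rule forest)
    moreover have "{u, u'} \<in> F" using e unfolding F_def label_class_def k_def by simp
    ultimately have "(u, u') \<notin> {(x, y). {x, y} \<in> F - {{u, u'}}}\<^sup>*"
      using graphD(7)[OF e] by (rule is_forest_edge_separates)
    then show False using uF by (rule notE)
  qed
  moreover have "u \<in> A" unfolding A_def using uD by blast
  moreover have AV: "A \<subseteq> V - W"
  proof
    fix b assume "b \<in> A"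
    then obtain x where x: "x \<in> D" "(x, b) \<in> R\<^sup>*" unfolding A_def by blast
    from x(2) show "b \<in> V - W" using x(1) by (cases rule: rtranclE) (auto simp: D_def R_def)
  qed
  moreover have "c \<in> A \<or> (a = u \<and> c = u')" if a: "a \<in> A" and ac: "{a, c} \<in> E" and c: "c \<notin> W" for a c
  proof -
    obtain x where x: "x \<in> D" "(u, x) \<in> T\<^sup>*" "(x, a) \<in> R\<^sup>*" using a unfolding A_def by blast
    have R_step: "c \<in> A" if "(a, c) \<in> R\<^sup>*"
      using x that unfolding A_def by (blast intro: rtrancl_trans)
    have aV: "a \<in> V - W" and cV: "c \<in> V - W" using AV a c graphD(6)[OF ac] by auto
    show ?thesis
    proof (cases "(a, c) \<in> R\<^sup>*")
      case True
      then show ?thesis using R_step by blast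
    next
      case nR: False
      have "lam {a, c} = k"
      proof (rule ccontr)
        assume "lam {a, c} \<noteq> k"
        then have "(a, c) \<in> R" using max[OF ac] ac aV cV unfolding R_def E'_def k_def by simp
        then show False using nR by blast
      qed
      then have lab: "{a, c} \<in> F" using ac by (simp add: F_def label_class_def)
      have nb: "{a, w} \<in> E'" "{c, w} \<in> E'" "w \<in> V" if "w \<in> base a c" for w
        using that \<open>lam {a, c} = k\<close> base_subset unfolding E'_def lower_common_neighbors_def by auto
      \<comment> \<open>A vertex of the base outside \<open>W\<close> would connect \<open>a\<close>
        to \<open>c\<close> by two \<open>R\<close>-steps. As (ML3) gives both sets
        \<open>k - 1\<close> elements, they coincide, and so \<open>a\<close> and \<open>c\<close>
        lie in \<open>D\<close>.\<close>
      have "base a c \<subseteq> W"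
      proof
        fix w assume w: "w \<in> base a c"
        show "w \<in> W"
        proof (rule ccontr)
          assume "w \<notin> W"
          then have "(a, w) \<in> R" "(w, c) \<in> R"
            using nb[OF w] aV cV unfolding R_def by (simp_all add: insert_commute)
          then show False using nR by (meson r_into_rtrancl rtrancl.rtrancl_into_rtrancl)
        qed
      qed
      moreover have "card (base a c) = card W" using card_base[OF ac] \<open>lam {a, c} = k\<close> cW by simp
      ultimately have eq: "base a c = W" using finW card_subset_eq by blast
      have acD: "a \<in> D" "c \<in> D" using nb aV cV unfolding eq D_def by auto
      then have xa: "x = a" using unique x by blast
      show ?thesis
      proof (cases "{a, c} = {u, u'}")
        case True
        then show ?thesis using \<open>u \<in> A\<close> by (auto simp: doubleton_eq_iff)
      next
        case False
        then have "(a, c) \<in> T" using acD lab unfolding T_def by simp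
        then have "(u, c) \<in> T\<^sup>*" using x(2) unfolding xa by simp
        then show ?thesis using acD unfolding A_def by blast
      qed
    qed
  qed
  ultimately show ?thesis using that unfolding W_def by blast
qed

text \<open>The side \<open>B\<close> is arbitrary so that the result serves both ends of the edge.
  The conclusion avoids \<open>u\<close> whenever \<open>B\<close> has other vertices, since the
  clique to be avoided later may contain \<open>u\<close>.\<close>

lemma mat_simplicial_beyond_edge:
  assumes e: "{u, u'} \<in> E" and max: "\<And>f. f \<in> E \<Longrightarrow> lam f \<le> lam {u, u'}"
    and B: "u \<in> B" "u' \<notin> B" "B \<subseteq> V - base u u'"
    and bd: "\<And>a c. a \<in> B \<Longrightarrow> {a, c} \<in> E \<Longrightarrow> c \<notin> base u u' \<Longrightarrow> c \<in> B \<or> (a = u \<and> c = u')"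
    and IH: "\<And>S K. S \<subset> V \<Longrightarrow> mat_graph S (induced_edges E S) lam \<Longrightarrow>
      is_clique (induced_edges E S) K \<Longrightarrow> label_closed (induced_edges E S) lam K \<Longrightarrow> K \<subset> S \<Longrightarrow>
      \<exists>v\<in>S - K. mat_simplicial S (induced_edges E S) lam v"
  shows "\<exists>v\<in>B. mat_simplicial V E lam v \<and> (B \<noteq> {u} \<longrightarrow> v \<noteq> u)"
proof (cases "B = {u}")
  case True
  have "neighbors E u \<subseteq> insert u' (base u u')"
  proof
    fix c assume "c \<in> neighbors E u"
    then have "{u, c} \<in> E" by (simp add: neighbors_def insert_commute)
    then show "c \<in> insert u' (base u u')" using bd[of u c] True graphD(7) by auto
  qed
  moreover have "insert u' (base u u') \<subseteq> neighbors E u"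
    using e unfolding neighbors_def lower_common_neighbors_def by (auto simp: insert_commute)
  ultimately have "mat_simplicial V E lam u" by (intro mat_simplicial_edge_end[OF e]) simp
  then show ?thesis using True by blast
next
  case False
  let ?W = "base u u'"
  let ?S = "B \<union> ?W"
  let ?K = "insert u ?W"
  let ?E = "induced_edges E ?S"
  have clK: "label_closed E lam ?K" using base_structure[OF e] by blast
  have SV: "?S \<subseteq> V" using B(3) base_subset by blast
  have "u' \<notin> ?W" using graphD(8) unfolding lower_common_neighbors_def by simp
  then have SV': "?S \<subset> V" using SV B(2) graphD(6)[OF e] by blast
  \<comment> \<open>The only edge from \<open>B\<close> that leaves \<open>?S\<close> is
    \<open>{u, u'}\<close>, whose label is too large.\<close>
  have inS: "z \<in> ?S" if "x \<in> B" "{x, z} \<in> E" "lam {x, z} < lam {u, u'}" for x z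
    using bd[OF that(1,2)] that(3) by auto
  have "label_closed E lam ?S" unfolding label_closed_def
  proof (intro ballI impI subsetI)
    fix x y z assume xy: "x \<in> ?S" "y \<in> ?S" "{x, y} \<in> E" and z: "z \<in> base x y"
    have lz: "{x, z} \<in> E" "{y, z} \<in> E" "lam {x, z} < lam {u, u'}" "lam {y, z} < lam {u, u'}"
      using z max[OF xy(3)] unfolding lower_common_neighbors_def by auto
    consider "x \<in> B" | "y \<in> B" | "x \<in> ?W" "y \<in> ?W" using xy by blast
    then show "z \<in> ?S"
    proof cases
      case 3
      then have "z \<in> ?K" using clK xy(3) z unfolding label_closed_def by blast
      then show ?thesis using B(1) by blast
    qed (use inS lz in blast)+
  qed
  then have mg: "mat_graph ?S ?E lam" using mat_graph_restrict SV by blast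
  have KS: "?K \<subset> ?S" using False B(1,3) by blast
  have "is_clique ?E ?K"
    using insert_base_clique[OF e] B(1) unfolding is_clique_def induced_edges_def by auto
  moreover have "label_closed ?E lam ?K"
    using clK unfolding label_closed_def induced_edges_def lower_common_neighbors_def by blast
  ultimately obtain v where v: "v \<in> ?S - ?K" "mat_simplicial ?S ?E lam v"
    using IH[OF SV' mg _ _ KS] by blast
  have vB: "v \<in> B" "v \<noteq> u" using v(1) by auto
  \<comment> \<open>As \<open>v\<close> differs from \<open>u\<close>, it has no neighbor outside
    \<open>?S\<close>, so being MAT-simplicial there carries over to the whole graph.\<close>
  have "neighbors E v \<subseteq> ?S" using bd[OF vB(1)] vB(2) unfolding neighbors_def
    by (auto simp: insert_commute)
  then have "mat_simplicial V E lam v" using mat_simplicial_induced_imp SV v(2) by blast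
  then show ?thesis using vB by blast
qed

end

section \<open>Existence of MAT-simplicial vertices\<close>

text \<open>The measure counts vertices and edges because the induction visits both graphs with
  fewer edges on possibly all vertices, for chordality, and induced subgraphs on fewer vertices, for
  the two sides.\<close>

theorem mat_simplicial_outside_closed_clique:
  assumes "mat_graph V E lam" "is_clique E K" "label_closed E lam K" "K \<subset> V"
  shows "\<exists>v\<in>V - K. mat_simplicial V E lam v"
  using assms
proof (induction "card V + card E" arbitrary: V E K rule: less_induct)
  case less
  interpret mat_graph V E lam by fact
  show ?case
  proof (cases "E = {}")
    case True
    then have "mat_simplicial V E lam v" if "v \<in> V" for v
      using that by (simp add: mat_simplicial_def neighbors_def is_clique_def vdegree_def)
    then show ?thesis using less.prems(4) by blast
  next
    case False
    have "chordal {e \<in> E. lam e < lam {x, y}}" if xy: "{x, y} \<in> E" for x y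
    proof (rule mat_graph_chordal[OF mat_graph_truncate])
      fix V' E' assume V': "V' \<subseteq> V" "E' \<subseteq> {e \<in> E. lam e < lam {x, y}}" "V' \<noteq> {}" "mat_graph V' E' lam"
      have "E' \<subset> E" using V'(2) xy by blast
      then have "card V' + card E' < card V + card E"
        using psubset_card_mono[OF graphD(2)] card_mono[OF graphD(1) V'(1)] by (simp add: add_le_less_mono)
      then have "\<exists>v\<in>V' - {}. mat_simplicial V' E' lam v"
        by (rule less.hyps) (use V' in \<open>auto simp: is_clique_def label_closed_def\<close>)
      then show "\<exists>v. mat_simplicial V' E' lam v" by blast
    qed
    then interpret chordal_mat_graph V E lam by unfold_locales
    have IH: "\<exists>v\<in>S - K. mat_simplicial S (induced_edges E S) lam v"
      if "S \<subset> V" "mat_graph S (induced_edges E S) lam" "is_clique (induced_edges E S) K"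
        "label_closed (induced_edges E S) lam K" "K \<subset> S" for S K
    proof -
      have "card (induced_edges E S) \<le> card E"
        using graphD(2) by (simp add: card_mono induced_edges_def)
      then have "card S + card (induced_edges E S) < card V + card E"
        using psubset_card_mono[OF graphD(1) that(1)] by simp
      then show ?thesis using less.hyps that(2-) by blast
    qed
    have "Max (lam ` E) \<in> lam ` E" using Max_in graphD(2) False by simp
    then obtain f where f: "f \<in> E" "Max (lam ` E) = lam f" by blast
    have fmax: "lam g \<le> lam f" if "g \<in> E" for g
      using Max_ge[of "lam ` E" "lam g"] graphD(2) that f(2) by simp
    obtain u u' where uu: "f = {u, u'}" using edge_obtain_pair[OF graph f(1)] by blast
    have e: "{u, u'} \<in> E" and max: "\<And>g. g \<in> E \<Longrightarrow> lam g \<le> lam {u, u'}"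
      using f(1) fmax unfolding uu by auto
    have e': "{u', u} \<in> E" and max': "\<And>g. g \<in> E \<Longrightarrow> lam g \<le> lam {u', u}"
      using e max by (simp_all add: insert_commute)
    have comm: "base u' u = base u u'" by (rule lower_common_neighbors_commute)
    obtain A where A: "u \<in> A" "u' \<notin> A" "A \<subseteq> V - base u u'"
      and bd: "\<And>a c. a \<in> A \<Longrightarrow> {a, c} \<in> E \<Longrightarrow> c \<notin> base u u' \<Longrightarrow> c \<in> A \<or> (a = u \<and> c = u')"
      using max_edge_separates[OF e max] by blast
    define B where "B = V - base u u' - A"
    have "u' \<notin> base u u'" using graphD(8) unfolding lower_common_neighbors_def by simp
    then have B: "u' \<in> B" "u \<notin> B" "B \<subseteq> V - base u' u"
      using A graphD(6)[OF e] unfolding B_def comm by auto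
    \<comment> \<open>The boundary condition for \<open>A\<close>, read along reversed edges, is the
      one for its complement \<open>B\<close>.\<close>
    have bd': "c \<in> B \<or> (a = u' \<and> c = u)"
      if "a \<in> B" "{a, c} \<in> E" "c \<notin> base u' u" for a c
    proof -
      have "{c, a} \<in> E" using that(2) by (simp add: insert_commute)
      then show ?thesis using bd[of c a] that graphD(6)[OF that(2)] unfolding B_def comm by blast
    qed
    have sideA: "\<exists>v\<in>A. mat_simplicial V E lam v \<and> (A \<noteq> {u} \<longrightarrow> v \<noteq> u)"
      using mat_simplicial_beyond_edge[OF e max A bd IH] by blast
    have sideB: "\<exists>v\<in>B. mat_simplicial V E lam v \<and> (B \<noteq> {u'} \<longrightarrow> v \<noteq> u')"
      using mat_simplicial_beyond_edge[OF e' max' B bd' IH] by blast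
    have AV: "A \<subseteq> V" and BV: "B \<subseteq> V" using A B by auto
    consider "K \<inter> A = {}" | "K \<inter> B = {}" | a b where "a \<in> K" "a \<in> A" "b \<in> K" "b \<in> B" by blast
    then show ?thesis
    proof cases
      case 1
      then show ?thesis using sideA AV by blast
    next
      case 2
      then show ?thesis using sideB BV by blast
    next
      case (3 a b)
      \<comment> \<open>Adjacent vertices on different sides can only be \<open>u\<close> and
        \<open>u'\<close>. So \<open>K\<close> meets \<open>A\<close> in \<open>u\<close> alone and
        \<open>B\<close> in \<open>u'\<close> alone.\<close>
      have cross: "a = u \<and> b = u'" if "a \<in> K" "a \<in> A" "b \<in> K" "b \<in> B" for a b
      proof -
        have "a \<noteq> b" "b \<notin> base u u'" "b \<notin> A" using that unfolding B_def by auto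
        then show ?thesis using bd[OF that(2)] is_cliqueD[OF less.prems(2) that(1,3)] by blast
      qed
      have uK: "u \<in> K" "u' \<in> K" using cross 3 by blast+
      then have "base u u' \<subseteq> K" using less.prems(3) e unfolding label_closed_def by blast
      moreover obtain c where c: "c \<in> V" "c \<notin> K" using less.prems(4) by blast
      \<comment> \<open>The vertex \<open>c\<close> outside \<open>K\<close> shows that its side is
        more than a single end of the edge. That side then provides a vertex other than this end,
        which \<open>cross\<close> keeps out of \<open>K\<close>.\<close>
      ultimately consider "c \<in> A" | "c \<in> B" unfolding B_def by blast
      then show ?thesis
      proof cases
        case 1
        then obtain v where v: "v \<in> A" "mat_simplicial V E lam v" "v \<noteq> u"
          using sideA c(2) uK by blast
        then show ?thesis using cross[of v u'] uK(2) B(1) AV by blast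
      next
        case 2
        then obtain v where v: "v \<in> B" "mat_simplicial V E lam v" "v \<noteq> u'"
          using sideB c(2) uK by blast
        then show ?thesis using cross[of u v] uK(1) A(1) BV by blast
      qed
    qed
  qed
qed

section \<open>Adding an MAT-simplicial vertex\<close>

text \<open>By (MS2) the vertex \<open>v\<close> meets at most one edge of each label, so cycles of
  constant label miss \<open>v\<close> and paths of constant label meet it only at an end. (MS3)
  then handles paths from \<open>v\<close> and the counts of (ML3).\<close>

lemma mat_labeling_add_simplicial:
  assumes G: "edge_labeled_graph V E lam" and v: "mat_simplicial V E lam v"
    and M: "mat_labeling (V - {v}) (induced_edges E (V - {v})) lam"
  shows "mat_labeling V E lam"
proof -
  note g = edge_labeled_graphD[OF G]
  let ?E = "induced_edges E (V - {v})"
  interpret H: mat_graph "V - {v}" ?E lam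
    by unfold_locales (use M edge_labeled_graph_induced[OF G] g(1) in auto)
  have N: "neighbors E v \<subseteq> V" unfolding neighbors_def using g(5) by blast
  have clique: "is_clique E (neighbors E v)"
    and labels: "(\<lambda>u. lam {u, v}) ` neighbors E v = {1..card (neighbors E v)}"
    and small: "\<And>a b. a \<in> neighbors E v \<Longrightarrow> b \<in> neighbors E v \<Longrightarrow> a \<noteq> b \<Longrightarrow>
      lam {a, b} < max (lam {a, v}) (lam {b, v})"
    using v unfolding mat_simplicial_def vdegree_def by auto
  \<comment> \<open>There are as many labels at \<open>v\<close> as neighbors.\<close>
  have inj: "inj_on (\<lambda>u. lam {u, v}) (neighbors E v)"
    using N g(1) labels by (intro eq_card_imp_inj_on) (auto intro: finite_subset)
  have E_iff: "{a, b} \<in> ?E \<longleftrightarrow> {a, b} \<in> E" if "a \<noteq> v" "b \<noteq> v" for a b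
    using that g(5,6) unfolding induced_edges_def by auto
  have unique: "a = b" if "{a, v} \<in> label_class E lam k" "{b, v} \<in> label_class E lam k" for a b k
    using inj that unfolding inj_on_def neighbors_def label_class_def by simp
  have path_H: "is_path (label_class ?E lam k) vs"
    if "is_path (label_class E lam k) vs" "v \<notin> set vs" for k vs
  proof -
    have "is_path {e \<in> label_class E lam k. e \<subseteq> - {v}} vs"
      by (rule is_path_restrict[OF that(1)]) (use that(2) in blast)
    then show ?thesis
      by (rule is_path_mono) (use g(3) in \<open>auto simp: label_class_def induced_edges_def\<close>)
  qed
  have forest: "is_forest (label_class E lam k)" for k
    unfolding is_forest_def
  proof
    assume "\<exists>vs. is_cycle (label_class E lam k) vs"
    then obtain vs where vs: "is_cycle (label_class E lam k) vs" by blast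
    have nv: "v \<notin> set vs" using is_cycle_neighbors[OF vs] unique by metis
    have ne: "vs \<noteq> []" using vs by (auto simp: is_cycle_def)
    have "last vs \<noteq> v" "hd vs \<noteq> v" using nv ne by auto
    then have "{last vs, hd vs} \<in> label_class ?E lam k"
      using vs E_iff unfolding is_cycle_def label_class_def by simp
    then have "is_cycle (label_class ?E lam k) vs" using vs path_H nv by (simp add: is_cycle_def)
    then show False using H.forest unfolding is_forest_def by blast
  qed
  have path_from_v: "k \<le> lam {v, last vs}"
    if p: "is_path (label_class E lam k) vs" and h: "hd vs = v" and e: "{v, last vs} \<in> E" for k vs
  proof (rule ccontr)
    \<comment> \<open>Then both the second and the last vertex are neighbors of \<open>v\<close> and
      their edge has label below \<open>k\<close> by (MS3), but the path without \<open>v\<close>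
      forces at least \<open>k\<close>.\<close>
    assume lt: "\<not> k \<le> lam {v, last vs}"
    obtain ys where ys: "vs = v # ys" using p h by (cases vs) (auto simp: is_path_def)
    have ne: "ys \<noteq> []" using e g(8) ys by auto
    have p': "v \<notin> set ys" "{v, hd ys} \<in> label_class E lam k" "is_path (label_class E lam k) ys"
      using p ne unfolding ys by (simp_all add: is_path_Cons)
    have l: "last vs = last ys" using ne ys by simp
    have hv: "hd ys \<noteq> v" "last ys \<noteq> v" using ne p'(1) by auto
    have lab: "lam {hd ys, v} = k" "{hd ys, v} \<in> E"
      using p'(2) by (simp_all add: label_class_def insert_commute)
    have e': "{last ys, v} \<in> E" "lam {last ys, v} < k"
      using e lt l by (simp_all add: insert_commute)
    have nb: "hd ys \<in> neighbors E v" "last ys \<in> neighbors E v" "hd ys \<noteq> last ys"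
      using lab e' unfolding neighbors_def by auto
    have "{hd ys, last ys} \<in> ?E" using is_cliqueD[OF clique nb] E_iff hv by simp
    then have "k \<le> lam {hd ys, last ys}" using H.path_label path_H p' by blast
    then show False using small[OF nb] lab e' by simp
  qed
  have path_label: "k \<le> lam {hd vs, last vs}"
    if p: "is_path (label_class E lam k) vs" and e: "{hd vs, last vs} \<in> E" for k vs
  proof -
    have ne: "vs \<noteq> []" using p by (simp add: is_path_def)
    consider "v \<notin> set vs" | "hd vs = v" | "last vs = v" | "v \<in> set vs" "v \<noteq> hd vs" "v \<noteq> last vs"
      by blast
    then show ?thesis
    proof cases
      case 1
      then have "hd vs \<noteq> v" "last vs \<noteq> v" using ne by auto
      then show ?thesis using H.path_label path_H p e E_iff 1 by blast
    next
      case 2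
      then show ?thesis using path_from_v p e by blast
    next
      case 3
      have "k \<le> lam {v, last (rev vs)}"
        by (rule path_from_v[OF is_path_rev[OF p]])
          (use 3 e ne in \<open>simp_all add: hd_rev last_rev insert_commute\<close>)
      then show ?thesis using 3 ne by (simp add: last_rev insert_commute)
    next
      case 4
      then show ?thesis using is_path_interior_neighbors[OF p] unique by metis
    qed
  qed
  have card_v: "card (lower_common_neighbors E lam v a) = lam {v, a} - 1" if "{v, a} \<in> E" for a
  proof -
    have flip: "{w, v} = {v, w}" for w by (rule insert_commute)
    let ?k = "lam {v, a}"
    let ?S = "{w \<in> neighbors E v. lam {v, w} < ?k}"
    have a: "a \<in> neighbors E v" using that unfolding neighbors_def flip by simp
    have "lower_common_neighbors E lam v a = ?S"
    proof (intro equalityI subsetI)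
      fix w assume "w \<in> lower_common_neighbors E lam v a"
      then show "w \<in> ?S" unfolding lower_common_neighbors_def neighbors_def flip by simp
    next
      fix w assume w: "w \<in> ?S"
      then have wa: "w \<in> neighbors E v" "a \<noteq> w" by auto
      have "{a, w} \<in> E" "lam {a, w} < ?k"
        using is_cliqueD[OF clique a wa] small[OF a wa] w unfolding flip by auto
      then show "w \<in> lower_common_neighbors E lam v a"
        using w unfolding lower_common_neighbors_def neighbors_def flip by simp
    qed
    moreover have "card ?S = card ((\<lambda>u. lam {u, v}) ` ?S)"
      using inj by (intro card_image[symmetric]) (auto intro: inj_on_subset)
    \<comment> \<open>The labels at \<open>v\<close> form an initial segment, so exactly
      \<open>?k - 1\<close> of them lie below \<open>?k\<close>.\<close>
    moreover have "(\<lambda>u. lam {u, v}) ` ?S = {1..<?k}"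
    proof -
      have k: "?k \<in> {1..card (neighbors E v)}" using a labels unfolding flip by blast
      have "(\<lambda>u. lam {u, v}) ` ?S = {j \<in> (\<lambda>u. lam {u, v}) ` neighbors E v. j < ?k}"
        unfolding flip by blast
      also have "\<dots> = {1..<?k}" unfolding labels using k by auto
      finally show ?thesis .
    qed
    ultimately show ?thesis by simp
  qed
  have "card (lower_common_neighbors E lam a b) = lam {a, b} - 1" if ab: "{a, b} \<in> E" for a b
  proof -
    consider "a = v" | "b = v" | "a \<noteq> v" "b \<noteq> v" by blast
    then show ?thesis
    proof cases
      case 1
      then show ?thesis using card_v ab by simp
    next
      case 2
      then show ?thesis
        using card_v[of a] ab lower_common_neighbors_commute[of E lam v a] by (simp add: insert_commute)
    next
      case 3
      have "v \<notin> lower_common_neighbors E lam a b"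
      proof
        assume "v \<in> lower_common_neighbors E lam a b"
        then have "a \<in> neighbors E v" "b \<in> neighbors E v" "lam {a, v} < lam {a, b}" "lam {b, v} < lam {a, b}"
          unfolding lower_common_neighbors_def neighbors_def by simp_all
        then show False using small[of a b] g(7)[OF ab] by simp
      qed
      then have "w \<in> lower_common_neighbors E lam a b \<longleftrightarrow> w \<in> lower_common_neighbors ?E lam a b" for w
        using E_iff[OF 3(1), of w] E_iff[OF 3(2), of w] g(8) H.base_subset[of a b]
        by (cases "w = v") (auto simp: lower_common_neighbors_def)
      then have "lower_common_neighbors E lam a b = lower_common_neighbors ?E lam a b" by blast
      then show ?thesis using H.card_base ab E_iff[OF 3] by simp
    qed
  qed
  then show ?thesis unfolding mat_labeling_iff[OF G] using forest path_label by blast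
qed

section \<open>Elimination orderings and the equivalence\<close>

lemma mat_peo_Nil: "mat_peo V E lam [] \<longleftrightarrow> V = {}"
  unfolding mat_peo_def by auto

text \<open>The last prefix is all of \<open>V\<close>, and every earlier prefix induces the same
  graph before and after deleting \<open>v\<close>.\<close>

lemma mat_peo_snoc:
  assumes G: "edge_labeled_graph V E lam"
  shows "mat_peo V E lam (vs @ [v]) \<longleftrightarrow>
    v \<in> V \<and> mat_peo (V - {v}) (induced_edges E (V - {v})) lam vs \<and> mat_simplicial V E lam v"
proof -
  have full: "induced_edges E V = E"
    using edge_labeled_graphD(3)[OF G] unfolding induced_edges_def by auto
  have nested: "induced_edges (induced_edges E S) T = induced_edges E T" if "T \<subseteq> S" for S T
    using that unfolding induced_edges_def by auto
  have prefix: "(\<forall>i\<in>{1..length (vs @ [v])}. P i (take i (vs @ [v])) ((vs @ [v]) ! (i - 1))) \<longleftrightarrow>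
      (\<forall>i\<in>{1..length vs}. P i (take i vs) (vs ! (i - 1))) \<and> P (Suc (length vs)) (vs @ [v]) v"
    for P :: "nat \<Rightarrow> 'a list \<Rightarrow> 'a \<Rightarrow> bool"
    by (auto simp: atLeastAtMostSuc_conv nth_append)
  have rest: "(\<forall>i\<in>{1..length vs}. mat_simplicial (set (take i vs))
        (induced_edges (induced_edges E (set vs)) (set (take i vs))) lam (vs ! (i - 1))) \<longleftrightarrow>
      (\<forall>i\<in>{1..length vs}. mat_simplicial (set (take i vs))
        (induced_edges E (set (take i vs))) lam (vs ! (i - 1)))"
    by (simp add: nested[OF set_take_subset])
  have "mat_peo V E lam (vs @ [v]) \<longleftrightarrow> v \<notin> set vs \<and> V = insert v (set vs) \<and> distinct vs \<and>
      (\<forall>i\<in>{1..length vs}. mat_simplicial (set (take i vs))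
        (induced_edges E (set (take i vs))) lam (vs ! (i - 1))) \<and>
      mat_simplicial V E lam v"
    unfolding mat_peo_def prefix[of "\<lambda>i xs x. mat_simplicial (set xs) (induced_edges E (set xs)) lam x"]
    using full by auto
  also have "\<dots> \<longleftrightarrow> v \<in> V \<and> V - {v} = set vs \<and> distinct vs \<and>
      (\<forall>i\<in>{1..length vs}. mat_simplicial (set (take i vs))
        (induced_edges E (set (take i vs))) lam (vs ! (i - 1))) \<and>
      mat_simplicial V E lam v"
    by blast
  also have "\<dots> \<longleftrightarrow>
      v \<in> V \<and> mat_peo (V - {v}) (induced_edges E (V - {v})) lam vs \<and> mat_simplicial V E lam v"
    unfolding mat_peo_def using rest by auto
  finally show ?thesis .
qed

lemma mat_peo_imp_mat_labeling:
  assumes "edge_labeled_graph V E lam" "mat_peo V E lam vs"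
  shows "mat_labeling V E lam"
  using assms
proof (induction vs arbitrary: V E rule: rev_induct)
  case Nil
  then have "V = {}" by (simp add: mat_peo_Nil)
  then have "{a, b} \<notin> E" for a b
    using edge_labeled_graphD(5)[OF Nil(1)] by blast
  then have "E = {}" using edge_obtain_pair[OF Nil(1)] by (metis all_not_in_conv)
  then show ?case unfolding mat_labeling_iff[OF Nil(1)]
    by (auto simp: label_class_def is_forest_def is_cycle_def)
next
  case (snoc v vs)
  have vs: "mat_peo (V - {v}) (induced_edges E (V - {v})) lam vs" and v: "mat_simplicial V E lam v"
    using snoc.prems(2) unfolding mat_peo_snoc[OF snoc.prems(1)] by simp_all
  have "edge_labeled_graph (V - {v}) (induced_edges E (V - {v})) lam"
    using edge_labeled_graph_induced[OF snoc.prems(1)] edge_labeled_graphD(1)[OF snoc.prems(1)]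
    by simp
  from mat_labeling_add_simplicial[OF snoc.prems(1) v snoc.IH[OF this vs]] show ?case .
qed

text \<open>The empty set is a label-closed clique, so a nonempty graph has an MAT-simplicial
  vertex; it becomes the last one in the ordering.\<close>

lemma mat_graph_imp_mat_peo:
  assumes "mat_graph V E lam"
  shows "\<exists>vs. mat_peo V E lam vs"
  using assms
proof (induction "card V" arbitrary: V E rule: less_induct)
  case less
  interpret mat_graph V E lam by fact
  show ?case
  proof (cases "V = {}")
    case True
    then show ?thesis using mat_peo_Nil by blast
  next
    case False
    then obtain v where v: "mat_simplicial V E lam v"
      using mat_simplicial_outside_closed_clique[OF less.prems, of "{}"]
      by (auto simp: is_clique_def label_closed_def)
    then have vV: "v \<in> V" by (simp add: mat_simplicial_def)
    have "mat_graph (V - {v}) (induced_edges E (V - {v})) lam"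
      by (rule mat_graph_restrict) (use v label_closed_remove_simplicial in auto)
    moreover have "card (V - {v}) < card V" using vV graphD(1) by (meson card_Diff1_less)
    ultimately obtain vs where "mat_peo (V - {v}) (induced_edges E (V - {v})) lam vs"
      using less.hyps by blast
    then show ?thesis using mat_peo_snoc[OF graph] v vV by blast
  qed
qed

theorem theorem5p5:
  fixes V :: "'a set" and E :: "'a set set" and lam :: "'a set \<Rightarrow> nat"
  assumes "edge_labeled_graph V E lam"
  shows "mat_labeling V E lam \<longleftrightarrow> (\<exists>vs. mat_peo V E lam vs)"
  using assms mat_graph_imp_mat_peo mat_peo_imp_mat_labeling mat_graph.intro by blast

end
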